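(* Let $G=\sum_{i=1}^n G_i$ be a disjunctive sum of mis\`ere \textsc{cricket pitch} positions $G_i$, each of which is a one-bump position (a single bump of some positive size $k$ on one side of the roller, i.e. $k\circledcirc$ or $\circledcirc k$). Let $\ell$ be the number of components $G_i$ with $o(G_i)=\mathcal{L}$ and $r$ the number of components with $o(G_i)=\mathcal{R}$. Then $o(G)=\mathcal{L}$ if $\ell>r$, $o(G)=\mathcal{N}$ if $\ell=r$, and $o(G)=\mathcal{R}$ if $\ell<r$.
   Context: \textsc{cricket pitch}: a row of bumps (non-negative integers) with a roller $\circledcirc$; Left moves the roller to the left, Right moves it to the right, over any positive number of consecutive bumps, each bump rolled over being reduced by $1$; a bump of size $0$ can no longer be rolled over. In a disjunctive sum a player on their turn moves in exactly one component. Mis\`ere play: the player unable to move on their turn wins. Outcome classes: $\mathcal{L}$ (Left wins whoever moves first), $\mathcal{R}$ (Right wins whoever moves first), $\mathcal{N}$ (the player moving first wins), $\mathcal{P}$ (the player moving second wins). *)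

theory Defs
  imports Main
begin

datatype player = Left | Right

fun opponent :: "player \<Rightarrow> player" where
  "opponent Left = Right"
| "opponent Right = Left"

text \<open>A ruleset is given by its options relation: \<open>mv p G G'\<close> means that player \<open>p\<close>
  can move from \<open>G\<close> to \<open>G'\<close>.\<close>

type_synonym 'a ruleset = "player \<Rightarrow> 'a \<Rightarrow> 'a \<Rightarrow> bool"

text \<open>Disjunctive sum of a finite family of positions: a move is made in exactly one component.\<close>

definition sum_move :: "'a ruleset \<Rightarrow> 'a list ruleset" where
  "sum_move mv p Gs Gs' \<longleftrightarrow> (\<exists>i<length Gs. \<exists>H. mv p (Gs ! i) H \<and> Gs' = Gs[i := H])"

text \<open>\<open>wins_first mv p G\<close> and \<open>wins_second mv p G\<close>: player \<open>p\<close> can force a win in \<open>G\<close> under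
  misere play when \<open>p\<close>, respectively the opponent of \<open>p\<close>, is to move. The player to move
  wins if unable to move, hence the existence premise in the last rule.\<close>

inductive wins_first :: "'a ruleset \<Rightarrow> player \<Rightarrow> 'a \<Rightarrow> bool"
  and wins_second :: "'a ruleset \<Rightarrow> player \<Rightarrow> 'a \<Rightarrow> bool"
  for mv :: "'a ruleset"
where
  stuck: "\<nexists>G'. mv p G G' \<Longrightarrow> wins_first mv p G"
| moves: "mv p G G' \<Longrightarrow> wins_second mv p G' \<Longrightarrow> wins_first mv p G"
| responds: "\<exists>G'. mv (opponent p) G G' \<Longrightarrow>
    (\<And>G'. mv (opponent p) G G' \<Longrightarrow> wins_first mv p G') \<Longrightarrow> wins_second mv p G"

datatype outcome_class = Class_L | Class_R | Class_N | Class_P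

text \<open>For a terminating ruleset the last case says that each player wins moving second; see
  \<open>outcome_iff\<close> below.\<close>

definition outcome :: "'a ruleset \<Rightarrow> 'a \<Rightarrow> outcome_class" where
  "outcome mv G =
    (if wins_first mv Left G \<and> wins_second mv Left G then Class_L
     else if wins_first mv Right G \<and> wins_second mv Right G then Class_R
     else if wins_first mv Left G \<and> wins_first mv Right G then Class_N
     else Class_P)"

text \<open>\<open>Pitch xs ys\<close> is the row of bumps \<open>xs\<close>, then the roller, then the row of bumps \<open>ys\<close>, both
  rows listed from left to right.\<close>

datatype pitch = Pitch "nat list" "nat list"

inductive pitch_move :: "pitch ruleset" where
  roll_left: "ys \<noteq> [] \<Longrightarrow> \<forall>y\<in>set ys. 0 < y \<Longrightarrow>
    pitch_move Left (Pitch (xs @ ys) zs) (Pitch xs (map (\<lambda>y. y - 1) ys @ zs))"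
| roll_right: "ys \<noteq> [] \<Longrightarrow> \<forall>y\<in>set ys. 0 < y \<Longrightarrow>
    pitch_move Right (Pitch xs (ys @ zs)) (Pitch (xs @ map (\<lambda>y. y - 1) ys) zs)"

definition one_bump :: "pitch \<Rightarrow> bool" where
  "one_bump G \<longleftrightarrow> (\<exists>k>0. G = Pitch [k] [] \<or> G = Pitch [] [k])"

lemma wins_first_iff:
  "wins_first mv p G \<longleftrightarrow> (\<nexists>G'. mv p G G') \<or> (\<exists>G'. mv p G G' \<and> wins_second mv p G')"
  by (subst wins_first.simps) blast

lemma wins_second_iff:
  "wins_second mv p G \<longleftrightarrow>
    (\<exists>G'. mv (opponent p) G G') \<and> (\<forall>G'. mv (opponent p) G G' \<longrightarrow> wins_first mv p G')"
  by (subst wins_second.simps) blast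

lemma opponent_opponent [simp]: "opponent (opponent p) = p"
  by (cases p) simp_all

lemma determined:
  assumes "wf {(G', G). \<exists>p. mv p G G'}"
  shows "wins_second mv (opponent p) G \<longleftrightarrow> \<not> wins_first mv p G"
  using assms
proof (induction G arbitrary: p rule: wf_induct_rule)
  case (less G)
  have "wins_first mv (opponent p) G' \<longleftrightarrow> \<not> wins_second mv p G'" if "mv p G G'" for G'
    using less[of G' "opponent p"] that by auto
  then show ?case
    by (subst wins_first_iff, subst wins_second_iff) auto
qed

lemma outcome_iff:
  assumes "wf {(G', G). \<exists>p. mv p G G'}"
  shows "outcome mv G = Class_L \<longleftrightarrow> wins_first mv Left G \<and> wins_second mv Left G"
    and "outcome mv G = Class_R \<longleftrightarrow> wins_first mv Right G \<and> wins_second mv Right G"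
    and "outcome mv G = Class_N \<longleftrightarrow> wins_first mv Left G \<and> wins_first mv Right G"
    and "outcome mv G = Class_P \<longleftrightarrow> wins_second mv Left G \<and> wins_second mv Right G"
  using determined[OF assms, of Left G] determined[OF assms, of Right G]
  by (auto simp: outcome_def)

fun pitch_size :: "pitch \<Rightarrow> nat" where
  "pitch_size (Pitch xs ys) = sum_list xs + sum_list ys"

lemma sum_list_roll_less:
  "ys \<noteq> [] \<Longrightarrow> \<forall>y\<in>set ys. 0 < y \<Longrightarrow> sum_list (map (\<lambda>y. y - 1) ys) < sum_list (ys :: nat list)"
proof (induction ys)
  case (Cons y ys)
  then show ?case by (cases "ys = []") auto
qed simp

lemma pitch_move_size: "pitch_move p G G' \<Longrightarrow> pitch_size G' < pitch_size G"
  by (induction rule: pitch_move.induct) (auto dest: sum_list_roll_less)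

lemma wf_pitch_move: "wf {(G', G). \<exists>p. pitch_move p G G'}"
  by (rule wf_subset[OF wf_measure[of pitch_size]]) (auto dest: pitch_move_size)

lemma sum_move_size:
  assumes "sum_move pitch_move p Gs Gs'"
  shows "sum_list (map pitch_size Gs') < sum_list (map pitch_size Gs)"
proof -
  obtain i H where i: "i < length Gs" and H: "pitch_move p (Gs ! i) H" and Gs': "Gs' = Gs[i := H]"
    using assms by (auto simp: sum_move_def)
  show ?thesis
    unfolding Gs' upd_conv_take_nth_drop[OF i] using pitch_move_size[OF H]
    by (subst (2) id_take_nth_drop[OF i]) simp
qed

lemma wf_sum_pitch_move: "wf {(Gs', Gs). \<exists>p. sum_move pitch_move p Gs Gs'}"
  by (rule wf_subset[OF wf_measure[of "\<lambda>Gs. sum_list (map pitch_size Gs)"]])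
    (auto dest: sum_move_size)

end

(*
  Give a one-bump position with an odd bump the value +1 if the bump is to the right of the roller
  and -1 if it is to the left, and give it the value 0 if the bump is even. Every Left move raises
  the total value of a sum by exactly 1 and every Right move lowers it by exactly 1, whatever move
  is chosen. A player can only be stuck when the value is zero or in their favour, so the sign of
  the value decides the game.
*)

theory Submission
  imports Defs
begin

fun player_sign :: "player \<Rightarrow> int" where
  "player_sign Left = 1"
| "player_sign Right = - 1"

lemma player_sign_opponent [simp]: "player_sign (opponent p) = - player_sign p"
  by (cases p) simp_all

lemma player_sign_mult_self [simp]: "player_sign p * player_sign p = 1"
  by (cases p) simp_all

text \<open>Stated abstractly because it is applied twice: to single components, which gives the
  classes counted by \<open>l\<close> and \<open>r\<close>, and to the sum itself.\<close>

locale unit_step_ruleset =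
  fixes mv :: "'a ruleset" and S :: "'a set" and d :: "'a \<Rightarrow> int"
  assumes closed: "G \<in> S \<Longrightarrow> mv p G G' \<Longrightarrow> G' \<in> S"
    and step: "G \<in> S \<Longrightarrow> mv p G G' \<Longrightarrow> d G' = d G + player_sign p"
    and can_move: "G \<in> S \<Longrightarrow> player_sign p * d G < 0 \<Longrightarrow> \<exists>G'. mv p G G'"
begin

text \<open>The two claims feed each other in one induction: from a value at least 0 for
  \<open>p\<close>, any move of \<open>p\<close> makes it positive; from a positive one, any reply
  leaves it at least 0, as \<open>d\<close> takes integer values.\<close>

lemma wins:
  assumes "wf {(G', G). \<exists>p. mv p G G'}" and "G \<in> S"
  shows "(0 \<le> player_sign p * d G \<longrightarrow> wins_first mv p G) \<and>
         (0 < player_sign p * d G \<longrightarrow> wins_second mv p G)"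
  using assms
proof (induction G rule: wf_induct_rule)
  case (less G)
  have IH: "0 \<le> player_sign p * d G' \<Longrightarrow> wins_first mv p G'"
    "0 < player_sign p * d G' \<Longrightarrow> wins_second mv p G'" if "mv q G G'" for q G'
    using less.IH[of G'] closed[OF less.prems that] that by auto
  show ?case
  proof (intro conjI impI)
    assume d: "0 \<le> player_sign p * d G"
    have "wins_second mv p G'" if "mv p G G'" for G'
      using IH(2)[OF that] step[OF less.prems that] d by (simp add: distrib_left)
    then show "wins_first mv p G"
      by (subst wins_first_iff) blast
  next
    assume d: "0 < player_sign p * d G"
    have "wins_first mv p G'" if "mv (opponent p) G G'" for G'
      using IH(1)[OF that] step[OF less.prems that] d by (simp add: right_diff_distrib)
    \<comment> \<open>Under misere play a stuck opponent would win. Seen from the opponent the value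
      is negative, so \<open>can_move\<close> rules this out.\<close>
    moreover have "\<exists>G'. mv (opponent p) G G'"
      using d by (intro can_move[OF less.prems]) simp
    ultimately show "wins_second mv p G"
      by (subst wins_second_iff) blast
  qed
qed

lemma outcome_by_sign:
  assumes "wf {(G', G). \<exists>p. mv p G G'}" and "G \<in> S"
  shows "0 < d G \<Longrightarrow> outcome mv G = Class_L"
    and "d G = 0 \<Longrightarrow> outcome mv G = Class_N"
    and "d G < 0 \<Longrightarrow> outcome mv G = Class_R"
  using wins[OF assms, of Left] wins[OF assms, of Right]
  by (auto simp: outcome_iff[OF assms(1)])

lemma unit_step_sum: "unit_step_ruleset (sum_move mv) (lists S) (\<lambda>Gs. sum_list (map d Gs))"
proof
  fix Gs p Gs'
  assume Gs: "Gs \<in> lists S" and "sum_move mv p Gs Gs'"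
  then obtain i H where i: "i < length Gs" and H: "mv p (Gs ! i) H" and Gs': "Gs' = Gs[i := H]"
    by (auto simp: sum_move_def)
  have S: "Gs ! i \<in> S"
    using Gs i by auto
  show "Gs' \<in> lists S"
    using Gs closed[OF S H] set_update_subset_insert[of Gs i H] unfolding Gs' by blast
  show "sum_list (map d Gs') = sum_list (map d Gs) + player_sign p"
    unfolding Gs' upd_conv_take_nth_drop[OF i] using step[OF S H]
    \<comment> \<open>Only the \<open>Gs\<close> on the right-hand side is split at
      \<open>i\<close>; the two sums then differ only in the component moved in.\<close>
    by (subst (3) id_take_nth_drop[OF i]) simp
next
  fix Gs p
  assume Gs: "Gs \<in> lists S" and neg: "player_sign p * sum_list (map d Gs) < 0"
  \<comment> \<open>A negative total has a negative summand, and in that component \<open>p\<close>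
    can move.\<close>
  have "\<exists>G\<in>set Gs. player_sign p * d G < 0"
  proof (rule ccontr)
    assume "\<not> ?thesis"
    then have "0 \<le> sum_list (map (\<lambda>G. player_sign p * d G) Gs)"
      by (intro sum_list_nonneg) auto
    with neg show False
      by (simp add: sum_list_const_mult)
  qed
  then obtain i where i: "i < length Gs" and "player_sign p * d (Gs ! i) < 0"
    by (metis in_set_conv_nth)
  moreover have "Gs ! i \<in> S"
    using Gs i by auto
  ultimately show "\<exists>Gs'. sum_move mv p Gs Gs'"
    using can_move[of "Gs ! i" p] by (auto simp: sum_move_def)
qed

end

text \<open>Bumps of size \<open>0\<close> are included, since play reaches them.\<close>

definition single_bumps :: "pitch set" where
  "single_bumps = {Pitch [k] [] | k. True} \<union> {Pitch [] [k] | k. True}"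

lemma one_bump_in_single_bumps: "one_bump G \<Longrightarrow> G \<in> single_bumps"
  by (auto simp: one_bump_def single_bumps_def)

fun pitch_value :: "pitch \<Rightarrow> int" where
  "pitch_value (Pitch xs ys) = int (sum_list ys mod 2) - int (sum_list xs mod 2)"

lemma pitch_move_left_bump:
  "pitch_move p (Pitch [k] []) G \<longleftrightarrow> p = Left \<and> 0 < k \<and> G = Pitch [] [k - 1]"
proof
  assume "pitch_move p (Pitch [k] []) G"
  then show "p = Left \<and> 0 < k \<and> G = Pitch [] [k - 1]"
    \<comment> \<open>The rolled segment is nonempty, so it is all of \<open>[k]\<close>.\<close>
    by cases (auto simp: Cons_eq_append_conv)
next
  assume "p = Left \<and> 0 < k \<and> G = Pitch [] [k - 1]"
  then show "pitch_move p (Pitch [k] []) G"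
    using roll_left[of "[k]" "[]" "[]"] by simp
qed

lemma pitch_move_right_bump:
  "pitch_move p (Pitch [] [k]) G \<longleftrightarrow> p = Right \<and> 0 < k \<and> G = Pitch [k - 1] []"
proof
  assume "pitch_move p (Pitch [] [k]) G"
  then show "p = Right \<and> 0 < k \<and> G = Pitch [k - 1] []"
    by cases (auto simp: Cons_eq_append_conv)
next
  assume "p = Right \<and> 0 < k \<and> G = Pitch [k - 1] []"
  then show "pitch_move p (Pitch [] [k]) G"
    using roll_right[of "[k]" "[]" "[]"] by simp
qed

text \<open>A roll flips both the side and the parity of the bump, and the parities of
  \<open>k\<close> and \<open>k - 1\<close> add up to 1. A value negative for \<open>p\<close> means
  an odd, hence nonzero, bump on the side towards which \<open>p\<close> rolls.\<close>

interpretation bump: unit_step_ruleset pitch_move single_bumps pitch_value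
proof
  fix G p
  assume "G \<in> single_bumps" and "player_sign p * pitch_value G < 0"
  then show "\<exists>G'. pitch_move p G G'"
    by (cases p) (auto simp: single_bumps_def pitch_move_left_bump pitch_move_right_bump
        intro!: Nat.gr0I)
qed (auto simp: single_bumps_def pitch_move_left_bump pitch_move_right_bump gr0_conv_Suc mod_Suc)

interpretation bump_sum: unit_step_ruleset "sum_move pitch_move" "lists single_bumps"
  "\<lambda>Gs. sum_list (map pitch_value Gs)"
  by (rule bump.unit_step_sum)

text \<open>The only values are -1, 0 and 1, and their signs force the classes R, N and L.\<close>

lemma pitch_value_eq_outcome:
  assumes "G \<in> single_bumps"
  shows "pitch_value G =
    of_bool (outcome pitch_move G = Class_L) - of_bool (outcome pitch_move G = Class_R)"
proof -
  have "pitch_value G \<in> {- 1, 0, 1}"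
    using assms by (auto simp: single_bumps_def)
  then show ?thesis
    using bump.outcome_by_sign[OF wf_pitch_move assms] by auto
qed

lemma sum_pitch_value_eq_outcome_counts:
  assumes "set Gs \<subseteq> single_bumps"
  shows "sum_list (map pitch_value Gs) =
    int (card {i. i < length Gs \<and> outcome pitch_move (Gs ! i) = Class_L}) -
    int (card {i. i < length Gs \<and> outcome pitch_move (Gs ! i) = Class_R})"
proof -
  \<comment> \<open>Lengths of filtered lists suit list induction better than cardinalities of index
    sets.\<close>
  have "sum_list (map pitch_value Gs) =
    int (length (filter (\<lambda>G. outcome pitch_move G = Class_L) Gs)) -
    int (length (filter (\<lambda>G. outcome pitch_move G = Class_R) Gs))"
    using assms by (induction Gs) (auto simp: pitch_value_eq_outcome)
  then show ?thesis
    by (simp add: length_filter_conv_card)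
qed

theorem theorem9:
  fixes Gs :: "pitch list" and l r :: nat
  assumes "\<forall>G\<in>set Gs. one_bump G"
    and "l = card {i. i < length Gs \<and> outcome pitch_move (Gs ! i) = Class_L}"
    and "r = card {i. i < length Gs \<and> outcome pitch_move (Gs ! i) = Class_R}"
  shows "(l > r \<longrightarrow> outcome (sum_move pitch_move) Gs = Class_L) \<and>
         (l = r \<longrightarrow> outcome (sum_move pitch_move) Gs = Class_N) \<and>
         (l < r \<longrightarrow> outcome (sum_move pitch_move) Gs = Class_R)"
proof -
  have sub: "set Gs \<subseteq> single_bumps"
    using assms(1) one_bump_in_single_bumps by blast
  have "sum_list (map pitch_value Gs) = int l - int r"
    using sum_pitch_value_eq_outcome_counts[OF sub] assms(2,3) by simp
  moreover have "Gs \<in> lists single_bumps"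
    using sub by auto
  ultimately show ?thesis
    using bump_sum.outcome_by_sign[OF wf_sum_pitch_move, of Gs] by auto
qed

end
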